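(* Let $(M,J,g)$ be a metallic-like pseudo-Riemannian manifold with associated tensor field $J^{\ast}$, let $\nabla$ be a linear connection on $M$ and let $\nabla^{\ast}$ be its $g$-conjugate connection. Then for all vector fields $X,Y,Z$ the following two identities hold: $$C(JX,Y,Z)=C(X,J^{\ast}Y,Z)+g\big(Y,(\nabla^{\ast}_ZJ)X-(\nabla_ZJ)X\big),$$ where $C=\nabla g$, and $$C^{\ast}(JX,Y,Z)=C^{\ast}(X,J^{\ast}Y,Z)+g\big(X,(\nabla^{\ast}_ZJ^{\ast})Y-(\nabla_ZJ^{\ast})Y\big),$$ where $C^{\ast}=\nabla^{\ast}g$.
   Context: A metallic structure on a smooth manifold $M$ is a $(1,1)$-tensor field $J$, which is a bundle isomorphism $TM\to TM$, such that $J^2=pJ+qI$ for some real numbers $p,q$ ($I$ the identity). A metallic-like pseudo-Riemannian manifold $(M,J,g)$ is a pseudo-Riemannian manifold $(M,g)$ with a metallic structure $J$ (not assumed $g$-symmetric) together with the $(1,1)$-tensor field $J^{\ast}$ satisfying $g(JX,Y)=g(X,J^{\ast}Y)$ for all vector fields $X,Y$ (so $(J^{\ast})^{\ast}=J$). The $g$-conjugate connection $\nabla^{\ast}$ of $\nabla$ is defined by $Zg(X,Y)=g(\nabla_ZX,Y)+g(X,\nabla^{\ast}_ZY)$. The index convention is $C(X,Y,Z)=(\nabla_Zg)(X,Y)=Zg(X,Y)-g(\nabla_ZX,Y)-g(X,\nabla_ZY)$ and $C^{\ast}(X,Y,Z)=(\nabla^{\ast}_Zg)(X,Y)$. *)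

theory Defs
  imports "HOL-Analysis.Analysis" "HOL-Library.Function_Algebras"
begin

text \<open>Functions, tangent vectors and vector fields are added, subtracted and (for real-valued
  functions) multiplied pointwise, using the instances of Function_Algebras.\<close>

text \<open>Meant for open \<^term>\<open>S\<close>: derivatives are taken in the full space.\<close>

primrec Ck_on ::
  "nat \<Rightarrow> 'e::real_normed_vector set \<Rightarrow> ('e \<Rightarrow> 'b::real_normed_vector) \<Rightarrow> bool" where
  "Ck_on 0 S f \<longleftrightarrow> continuous_on S f"
| "Ck_on (Suc k) S f \<longleftrightarrow>
     (\<forall>x\<in>S. f differentiable (at x)) \<and> (\<forall>v. Ck_on k S (\<lambda>x. frechet_derivative f (at x) v))"

definition Cinf_on :: "'e::real_normed_vector set \<Rightarrow> ('e \<Rightarrow> 'b::real_normed_vector) \<Rightarrow> bool" where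
  "Cinf_on S f \<longleftrightarrow> (\<forall>k. Ck_on k S f)"

text \<open>A chart is a pair of its domain and its coordinate map; values of the coordinate map outside
  the domain are irrelevant. The model space is a Euclidean space type, whose dimension is the
  dimension of the manifold. The atlas need not be maximal.\<close>

record ('a, 'e) mfd =
  mtop :: "'a topology"
  charts :: "('a set \<times> ('a \<Rightarrow> 'e)) set"

abbreviation points :: "('a, 'e, 'z) mfd_scheme \<Rightarrow> 'a set" where
  "points M \<equiv> topspace (mtop M)"

definition is_chart :: "'a topology \<Rightarrow> 'a set \<Rightarrow> ('a \<Rightarrow> 'e::euclidean_space) \<Rightarrow> bool" where
  "is_chart T U \<phi> \<longleftrightarrow>
     openin T U \<and> open (\<phi> ` U) \<and>
     homeomorphic_map (subtopology T U) (top_of_set (\<phi> ` U)) \<phi>"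

definition smooth_manifold :: "('a, 'e::euclidean_space) mfd \<Rightarrow> bool" where
  "smooth_manifold M \<longleftrightarrow>
     Hausdorff_space (mtop M) \<and> second_countable (mtop M) \<and>
     (\<forall>(U, \<phi>)\<in>charts M. is_chart (mtop M) U \<phi>) \<and>
     (\<Union>(U, \<phi>)\<in>charts M. U) = points M \<and>
     (\<forall>(U, \<phi>)\<in>charts M. \<forall>(V, \<psi>)\<in>charts M. Cinf_on (\<phi> ` (U \<inter> V)) (\<psi> \<circ> inv_into U \<phi>))"

text \<open>All objects living over the manifold are normalised to vanish off its carrier, so that
  equality of objects over the manifold is equality in HOL.\<close>

definition on_mfd :: "('a, 'e) mfd \<Rightarrow> ('a \<Rightarrow> 'b::zero) \<Rightarrow> 'a \<Rightarrow> 'b" where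
  "on_mfd M F = (\<lambda>x. if x \<in> points M then F x else 0)"

definition smooth_fun :: "('a, 'e::euclidean_space) mfd \<Rightarrow> ('a \<Rightarrow> real) set" where
  "smooth_fun M =
     {f. (\<forall>x. x \<notin> points M \<longrightarrow> f x = 0) \<and>
         (\<forall>(U, \<phi>)\<in>charts M. Cinf_on (\<phi> ` U) (f \<circ> inv_into U \<phi>))}"

type_synonym 'a tvec = "('a \<Rightarrow> real) \<Rightarrow> real"
type_synonym 'a vfield = "'a \<Rightarrow> 'a tvec"

definition tscale :: "real \<Rightarrow> 'a tvec \<Rightarrow> 'a tvec" where
  "tscale c v = (\<lambda>f. c * v f)"

text \<open>Tangent vectors at a point are the derivations at that point of the algebra of smooth
  functions.\<close>

definition tangent_space :: "('a, 'e::euclidean_space) mfd \<Rightarrow> 'a \<Rightarrow> 'a tvec set" where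
  "tangent_space M x =
     {v. (\<forall>f\<in>smooth_fun M. \<forall>h\<in>smooth_fun M. v (f + h) = v f + v h) \<and>
         (\<forall>c. \<forall>f\<in>smooth_fun M. v (\<lambda>y. c * f y) = c * v f) \<and>
         (\<forall>f\<in>smooth_fun M. \<forall>h\<in>smooth_fun M. v (f * h) = f x * v h + h x * v f) \<and>
         (\<forall>f. f \<notin> smooth_fun M \<longrightarrow> v f = 0)}"

definition vapply :: "'a vfield \<Rightarrow> ('a \<Rightarrow> real) \<Rightarrow> 'a \<Rightarrow> real" where
  "vapply Z f = (\<lambda>x. Z x f)"

definition vector_fields :: "('a, 'e::euclidean_space) mfd \<Rightarrow> 'a vfield set" where
  "vector_fields M =
     {X. (\<forall>x\<in>points M. X x \<in> tangent_space M x) \<and> (\<forall>x. x \<notin> points M \<longrightarrow> X x = 0) \<and>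
         (\<forall>f\<in>smooth_fun M. vapply X f \<in> smooth_fun M)}"

definition fscale :: "('a \<Rightarrow> real) \<Rightarrow> 'a vfield \<Rightarrow> 'a vfield" where
  "fscale f X = (\<lambda>x. tscale (f x) (X x))"

text \<open>Smoothness of a pointwise tensor is expressed by its sending smooth vector fields to smooth
  vector fields, respectively functions.\<close>

definition endo_app :: "('a, 'e) mfd \<Rightarrow> ('a \<Rightarrow> 'a tvec \<Rightarrow> 'a tvec) \<Rightarrow> 'a vfield \<Rightarrow> 'a vfield" where
  "endo_app M J X = on_mfd M (\<lambda>x. J x (X x))"

definition tensor_field_11 ::
  "('a, 'e::euclidean_space) mfd \<Rightarrow> ('a \<Rightarrow> 'a tvec \<Rightarrow> 'a tvec) \<Rightarrow> bool" where
  "tensor_field_11 M J \<longleftrightarrow>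
     (\<forall>x\<in>points M. \<forall>v\<in>tangent_space M x.
        J x v \<in> tangent_space M x \<and>
        (\<forall>w\<in>tangent_space M x. J x (v + w) = J x v + J x w) \<and>
        (\<forall>c. J x (tscale c v) = tscale c (J x v))) \<and>
     (\<forall>X\<in>vector_fields M. endo_app M J X \<in> vector_fields M)"

definition g_app ::
  "('a, 'e) mfd \<Rightarrow> ('a \<Rightarrow> 'a tvec \<Rightarrow> 'a tvec \<Rightarrow> real) \<Rightarrow> 'a vfield \<Rightarrow> 'a vfield \<Rightarrow> 'a \<Rightarrow> real" where
  "g_app M g X Y = on_mfd M (\<lambda>x. g x (X x) (Y x))"

text \<open>Linearity in the second argument follows from symmetry. No condition is put on the index.\<close>

definition pseudo_riemannian_metric ::
  "('a, 'e::euclidean_space) mfd \<Rightarrow> ('a \<Rightarrow> 'a tvec \<Rightarrow> 'a tvec \<Rightarrow> real) \<Rightarrow> bool" where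
  "pseudo_riemannian_metric M g \<longleftrightarrow>
     (\<forall>x\<in>points M. \<forall>u\<in>tangent_space M x. \<forall>v\<in>tangent_space M x.
        g x u v = g x v u \<and>
        (\<forall>w\<in>tangent_space M x. g x (u + w) v = g x u v + g x w v) \<and>
        (\<forall>c. g x (tscale c u) v = c * g x u v)) \<and>
     (\<forall>x\<in>points M. \<forall>u\<in>tangent_space M x.
        (\<forall>v\<in>tangent_space M x. g x u v = 0) \<longrightarrow> u = 0) \<and>
     (\<forall>X\<in>vector_fields M. \<forall>Y\<in>vector_fields M. g_app M g X Y \<in> smooth_fun M)"

text \<open>\<^term>\<open>D Z X\<close> is the covariant derivative of \<^term>\<open>X\<close> in the direction \<^term>\<open>Z\<close>. Real-linearity
  in \<^term>\<open>X\<close> is the Leibniz rule for constant functions.\<close>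

definition linear_connection ::
  "('a, 'e::euclidean_space) mfd \<Rightarrow> ('a vfield \<Rightarrow> 'a vfield \<Rightarrow> 'a vfield) \<Rightarrow> bool" where
  "linear_connection M D \<longleftrightarrow>
     (\<forall>Z\<in>vector_fields M. \<forall>X\<in>vector_fields M.
        D Z X \<in> vector_fields M \<and>
        (\<forall>W\<in>vector_fields M. D (Z + W) X = D Z X + D W X) \<and>
        (\<forall>Y\<in>vector_fields M. D Z (X + Y) = D Z X + D Z Y) \<and>
        (\<forall>f\<in>smooth_fun M.
           D (fscale f Z) X = fscale f (D Z X) \<and>
           D Z (fscale f X) = fscale f (D Z X) + fscale (vapply Z f) X))"

definition conjugate_connection ::
  "('a, 'e::euclidean_space) mfd \<Rightarrow> ('a \<Rightarrow> 'a tvec \<Rightarrow> 'a tvec \<Rightarrow> real) \<Rightarrow>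
   ('a vfield \<Rightarrow> 'a vfield \<Rightarrow> 'a vfield) \<Rightarrow> ('a vfield \<Rightarrow> 'a vfield \<Rightarrow> 'a vfield) \<Rightarrow> bool" where
  "conjugate_connection M g D D' \<longleftrightarrow>
     linear_connection M D' \<and>
     (\<forall>X\<in>vector_fields M. \<forall>Y\<in>vector_fields M. \<forall>Z\<in>vector_fields M.
        vapply Z (g_app M g X Y) = g_app M g (D Z X) Y + g_app M g X (D' Z Y))"

text \<open>\<^term>\<open>cov_endo M D J Z X\<close> is \<open>(\<nabla>\<^sub>Z J) X\<close>.\<close>

definition cov_endo ::
  "('a, 'e) mfd \<Rightarrow> ('a vfield \<Rightarrow> 'a vfield \<Rightarrow> 'a vfield) \<Rightarrow> ('a \<Rightarrow> 'a tvec \<Rightarrow> 'a tvec) \<Rightarrow>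
   'a vfield \<Rightarrow> 'a vfield \<Rightarrow> 'a vfield" where
  "cov_endo M D J Z X = D Z (endo_app M J X) - endo_app M J (D Z X)"

text \<open>The direction of differentiation is the last argument: \<^term>\<open>cov_metric M D g X Y Z\<close> is
  \<open>(\<nabla>\<^sub>Z g)(X, Y)\<close>.\<close>

definition cov_metric ::
  "('a, 'e) mfd \<Rightarrow> ('a vfield \<Rightarrow> 'a vfield \<Rightarrow> 'a vfield) \<Rightarrow>
   ('a \<Rightarrow> 'a tvec \<Rightarrow> 'a tvec \<Rightarrow> real) \<Rightarrow> 'a vfield \<Rightarrow> 'a vfield \<Rightarrow> 'a vfield \<Rightarrow> 'a \<Rightarrow> real" where
  "cov_metric M D g X Y Z =
     vapply Z (g_app M g X Y) - g_app M g (D Z X) Y - g_app M g X (D Z Y)"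

definition bundle_automorphism ::
  "('a, 'e::euclidean_space) mfd \<Rightarrow> ('a \<Rightarrow> 'a tvec \<Rightarrow> 'a tvec) \<Rightarrow> bool" where
  "bundle_automorphism M J \<longleftrightarrow>
     tensor_field_11 M J \<and>
     (\<exists>K. tensor_field_11 M K \<and>
        (\<forall>x\<in>points M. \<forall>v\<in>tangent_space M x. K x (J x v) = v \<and> J x (K x v) = v))"

definition metallic_structure ::
  "('a, 'e::euclidean_space) mfd \<Rightarrow> ('a \<Rightarrow> 'a tvec \<Rightarrow> 'a tvec) \<Rightarrow> bool" where
  "metallic_structure M J \<longleftrightarrow>
     bundle_automorphism M J \<and>
     (\<exists>p q :: real. \<forall>x\<in>points M. \<forall>v\<in>tangent_space M x.
        J x (J x v) = tscale p (J x v) + tscale q v)"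

definition metallic_like_pseudo_riemannian ::
  "('a, 'e::euclidean_space) mfd \<Rightarrow> ('a \<Rightarrow> 'a tvec \<Rightarrow> 'a tvec) \<Rightarrow>
   ('a \<Rightarrow> 'a tvec \<Rightarrow> 'a tvec \<Rightarrow> real) \<Rightarrow> bool" where
  "metallic_like_pseudo_riemannian M J g \<longleftrightarrow>
     smooth_manifold M \<and> pseudo_riemannian_metric M g \<and> metallic_structure M J"

definition associated_tensor ::
  "('a, 'e::euclidean_space) mfd \<Rightarrow> ('a \<Rightarrow> 'a tvec \<Rightarrow> 'a tvec \<Rightarrow> real) \<Rightarrow>
   ('a \<Rightarrow> 'a tvec \<Rightarrow> 'a tvec) \<Rightarrow> ('a \<Rightarrow> 'a tvec \<Rightarrow> 'a tvec) \<Rightarrow> bool" where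
  "associated_tensor M g J J' \<longleftrightarrow>
     tensor_field_11 M J' \<and>
     (\<forall>X\<in>vector_fields M. \<forall>Y\<in>vector_fields M.
        g_app M g (endo_app M J X) Y = g_app M g X (endo_app M J' Y))"

end

theory Submission
  imports Defs
begin

text \<open>Substituting the defining property of the conjugate
  connection \<open>\<nabla>\<^sup>*\<close> into \<open>C(X,Y,Z)\<close> removes every derivative of a function and leaves
  \<open>C(X,Y,Z) = g(X, \<nabla>\<^sup>*\<^sub>Z Y - \<nabla>\<^sub>Z Y)\<close> (lemma \<open>cov_metric_conjugate\<close>). As \<open>C\<close> is symmetric in \<open>X\<close>
  and \<open>Y\<close>, the first identity compares
  \<open>g(Y, \<nabla>\<^sup>*\<^sub>Z(JX) - \<nabla>\<^sub>Z(JX))\<close> with \<open>g(J\<^sup>*Y, \<nabla>\<^sup>*\<^sub>Z X - \<nabla>\<^sub>Z X) = g(Y, J \<nabla>\<^sup>*\<^sub>Z X - J \<nabla>\<^sub>Z X)\<close>, and the two arguments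
  differ by \<open>(\<nabla>\<^sup>*\<^sub>Z J)X - (\<nabla>\<^sub>Z J)X\<close> (lemma \<open>cov_metric_endo_left\<close>).

  The second identity is the first one after duality: \<open>\<nabla>\<close> is the conjugate of \<open>\<nabla>\<^sup>*\<close> and \<open>J\<close> is the
  adjoint of \<open>J\<^sup>*\<close>, so the first identity may be applied to \<open>(\<nabla>\<^sup>*, \<nabla>, J\<^sup>*, J)\<close> and to \<open>Y, X\<close>.
  Solving the result for the other occurrence of \<open>C\<^sup>*\<close> reverses the sign of the correction term.\<close>

lemma tangent_space_diff:
  assumes "u \<in> tangent_space M x" and "v \<in> tangent_space M x"
  shows "u - v \<in> tangent_space M x"
  using assms by (simp add: tangent_space_def algebra_simps)

lemma vector_field_at:
  assumes "X \<in> vector_fields M" and "x \<in> points M"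
  shows "X x \<in> tangent_space M x"
  using assms by (simp add: vector_fields_def)

lemma metric_sym:
  assumes "pseudo_riemannian_metric M g" and "x \<in> points M"
    and "u \<in> tangent_space M x" and "v \<in> tangent_space M x"
  shows "g x u v = g x v u"
  using assms(1)[unfolded pseudo_riemannian_metric_def, THEN conjunct1, rule_format, OF assms(2-4)]
  by blast

lemma metric_diff_right:
  assumes g: "pseudo_riemannian_metric M g" and x: "x \<in> points M"
    and u: "u \<in> tangent_space M x"
    and v: "v \<in> tangent_space M x" and w: "w \<in> tangent_space M x"
  shows "g x u (v - w) = g x u v - g x u w"
proof -
  have d: "v - w \<in> tangent_space M x"
    using v w by (rule tangent_space_diff)
  have "g x ((v - w) + w) u = g x (v - w) u + g x w u"
    using g[unfolded pseudo_riemannian_metric_def, THEN conjunct1, rule_format, OF x d u] w by blast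
  then have "g x v u = g x (v - w) u + g x w u"
    by simp
  then show ?thesis
    using metric_sym[OF g x u v] metric_sym[OF g x u w] metric_sym[OF g x u d] by simp
qed

lemma g_app_sym:
  assumes "pseudo_riemannian_metric M g" and "X \<in> vector_fields M" and "Y \<in> vector_fields M"
  shows "g_app M g X Y = g_app M g Y X"
  using metric_sym[OF assms(1) _ vector_field_at[OF assms(2)] vector_field_at[OF assms(3)]]
  by (simp add: g_app_def on_mfd_def fun_eq_iff)

text \<open>Here \<open>A\<close> and \<open>B\<close> may be any, possibly non-smooth, sections of the tangent bundle: the
  rule is pointwise, so it applies to nested differences such as \<open>(\<nabla>\<^sup>*\<^sub>Z J)X - (\<nabla>\<^sub>Z J)X\<close>, whose terms need only
  be tangent at each point.\<close>

lemma g_app_diff_right: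
  assumes "pseudo_riemannian_metric M g" and "X \<in> vector_fields M"
    and "\<And>x. x \<in> points M \<Longrightarrow> A x \<in> tangent_space M x"
    and "\<And>x. x \<in> points M \<Longrightarrow> B x \<in> tangent_space M x"
  shows "g_app M g X (A - B) = g_app M g X A - g_app M g X B"
proof
  fix x
  show "g_app M g X (A - B) x = (g_app M g X A - g_app M g X B) x"
    using metric_diff_right[OF assms(1) _ vector_field_at[OF assms(2)] assms(3) assms(4), of x]
    by (simp add: g_app_def on_mfd_def fun_diff_def[of A B])
qed

lemma connection_closed:
  assumes "linear_connection M D" and "Z \<in> vector_fields M" and "X \<in> vector_fields M"
  shows "D Z X \<in> vector_fields M"
  using assms unfolding linear_connection_def by blast

lemma tensor_field_closed:
  assumes "tensor_field_11 M J" and "X \<in> vector_fields M"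
  shows "endo_app M J X \<in> vector_fields M"
  using assms unfolding tensor_field_11_def by blast

lemma cov_endo_at:
  assumes D: "linear_connection M D" and J: "tensor_field_11 M J"
    and X: "X \<in> vector_fields M" and Z: "Z \<in> vector_fields M" and x: "x \<in> points M"
  shows "cov_endo M D J Z X x \<in> tangent_space M x"
  using tangent_space_diff[OF
      vector_field_at[OF connection_closed[OF D Z tensor_field_closed[OF J X]] x]
      vector_field_at[OF tensor_field_closed[OF J connection_closed[OF D Z X]] x]]
  by (simp add: cov_endo_def fun_diff_def[of "D Z (endo_app M J X)"])

lemma conjugate_connection_sym:
  assumes g: "pseudo_riemannian_metric M g" and D: "linear_connection M D"
    and conj: "conjugate_connection M g D D'"
  shows "conjugate_connection M g D' D"
  unfolding conjugate_connection_def
proof (intro conjI ballI D)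
  fix X Y Z
  assume X: "X \<in> vector_fields M" and Y: "Y \<in> vector_fields M" and Z: "Z \<in> vector_fields M"
  have D': "linear_connection M D'"
    using conj by (simp add: conjugate_connection_def)
  have "vapply Z (g_app M g Y X) = g_app M g (D Z Y) X + g_app M g Y (D' Z X)"
    using conj X Y Z unfolding conjugate_connection_def by blast
  then show "vapply Z (g_app M g X Y) = g_app M g (D' Z X) Y + g_app M g X (D Z Y)"
    using g_app_sym[OF g X Y] g_app_sym[OF g connection_closed[OF D Z Y] X]
      g_app_sym[OF g Y connection_closed[OF D' Z X]]
    by (simp add: add.commute)
qed

lemma associated_tensor_sym:
  assumes g: "pseudo_riemannian_metric M g" and J: "tensor_field_11 M J"
    and adj: "associated_tensor M g J J'"
  shows "associated_tensor M g J' J"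
  unfolding associated_tensor_def
proof (intro conjI ballI J)
  fix X Y
  assume X: "X \<in> vector_fields M" and Y: "Y \<in> vector_fields M"
  have J': "tensor_field_11 M J'"
    using adj by (simp add: associated_tensor_def)
  have "g_app M g (endo_app M J Y) X = g_app M g Y (endo_app M J' X)"
    using adj X Y unfolding associated_tensor_def by blast
  then show "g_app M g (endo_app M J' X) Y = g_app M g X (endo_app M J Y)"
    using g_app_sym[OF g X tensor_field_closed[OF J Y]]
      g_app_sym[OF g Y tensor_field_closed[OF J' X]]
    by simp
qed

lemma cov_metric_sym:
  assumes g: "pseudo_riemannian_metric M g" and D: "linear_connection M D"
    and X: "X \<in> vector_fields M" and Y: "Y \<in> vector_fields M" and Z: "Z \<in> vector_fields M"
  shows "cov_metric M D g X Y Z = cov_metric M D g Y X Z"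
  using g_app_sym[OF g X Y] g_app_sym[OF g connection_closed[OF D Z X] Y]
    g_app_sym[OF g X connection_closed[OF D Z Y]]
  by (simp add: cov_metric_def algebra_simps)

text \<open>Conjugacy replaces the derivative of \<open>g(X,Y)\<close> by two metric terms, one of which cancels. Hence
  the non-metricity of a connection measures its deviation from its conjugate.\<close>

lemma cov_metric_conjugate:
  assumes "conjugate_connection M g D D'"
    and "X \<in> vector_fields M" and "Y \<in> vector_fields M" and "Z \<in> vector_fields M"
  shows "cov_metric M D g X Y Z = g_app M g X (D' Z Y) - g_app M g X (D Z Y)"
  using assms by (simp add: cov_metric_def conjugate_connection_def)

text \<open>The difference of the two covariant derivatives of \<open>J\<close>, paired with \<open>Y\<close>, splits into the
  deviation of the connections at \<open>JX\<close> and at \<open>X\<close>, the latter carried over to \<open>J\<^sup>*Y\<close> by adjointness.\<close>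

lemma cov_metric_endo_left:
  assumes g: "pseudo_riemannian_metric M g" and J: "tensor_field_11 M J"
    and adj: "associated_tensor M g J J'"
    and D: "linear_connection M D" and conj: "conjugate_connection M g D D'"
    and X: "X \<in> vector_fields M" and Y: "Y \<in> vector_fields M" and Z: "Z \<in> vector_fields M"
  shows "cov_metric M D g (endo_app M J X) Y Z =
           cov_metric M D g X (endo_app M J' Y) Z +
           g_app M g Y (cov_endo M D' J Z X - cov_endo M D J Z X)"
proof -
  have D': "linear_connection M D'"
    using conj by (simp add: conjugate_connection_def)
  have J': "tensor_field_11 M J'"
    using adj by (simp add: associated_tensor_def)
  note JX = tensor_field_closed[OF J X] and J'Y = tensor_field_closed[OF J' Y]
  have cov_J: "g_app M g Y (cov_endo M E J Z X) =
      g_app M g Y (E Z (endo_app M J X)) - g_app M g (endo_app M J' Y) (E Z X)"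
    if E: "linear_connection M E" for E
  proof -
    note EJX = connection_closed[OF E Z JX] and EX = connection_closed[OF E Z X]
    note JEX = tensor_field_closed[OF J EX]
    have "g_app M g (endo_app M J' Y) (E Z X) = g_app M g Y (endo_app M J (E Z X))"
      using associated_tensor_sym[OF g J adj] Y EX unfolding associated_tensor_def by blast
    then show "g_app M g Y (cov_endo M E J Z X) =
        g_app M g Y (E Z (endo_app M J X)) - g_app M g (endo_app M J' Y) (E Z X)"
      using g_app_diff_right[OF g Y vector_field_at[OF EJX] vector_field_at[OF JEX]]
      by (simp add: cov_endo_def)
  qed
  have "cov_metric M D g (endo_app M J X) Y Z = cov_metric M D g Y (endo_app M J X) Z"
    by (rule cov_metric_sym[OF g D JX Y Z])
  also have "\<dots> = g_app M g Y (D' Z (endo_app M J X)) - g_app M g Y (D Z (endo_app M J X))"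
    by (rule cov_metric_conjugate[OF conj Y JX Z])
  also have "\<dots> = (g_app M g (endo_app M J' Y) (D' Z X) - g_app M g (endo_app M J' Y) (D Z X)) +
      g_app M g Y (cov_endo M D' J Z X - cov_endo M D J Z X)"
    by (simp add: g_app_diff_right[OF g Y cov_endo_at[OF D' J X Z] cov_endo_at[OF D J X Z]]
        cov_J[OF D] cov_J[OF D'])
  also have "\<dots> = cov_metric M D g (endo_app M J' Y) X Z +
      g_app M g Y (cov_endo M D' J Z X - cov_endo M D J Z X)"
    by (simp add: cov_metric_conjugate[OF conj J'Y X Z])
  finally show ?thesis
    by (simp add: cov_metric_sym[OF g D J'Y X Z])
qed

theorem proposition24:
  fixes M :: "('a, 'e::euclidean_space) mfd"
    and J J' :: "'a \<Rightarrow> 'a tvec \<Rightarrow> 'a tvec"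
    and g :: "'a \<Rightarrow> 'a tvec \<Rightarrow> 'a tvec \<Rightarrow> real"
    and D D' :: "'a vfield \<Rightarrow> 'a vfield \<Rightarrow> 'a vfield"
    and X Y Z :: "'a vfield"
  assumes "metallic_like_pseudo_riemannian M J g"
    and "associated_tensor M g J J'"
    and "linear_connection M D"
    and "conjugate_connection M g D D'"
    and "X \<in> vector_fields M" and "Y \<in> vector_fields M" and "Z \<in> vector_fields M"
  shows "cov_metric M D g (endo_app M J X) Y Z =
           cov_metric M D g X (endo_app M J' Y) Z +
           g_app M g Y (cov_endo M D' J Z X - cov_endo M D J Z X) \<and>
         cov_metric M D' g (endo_app M J X) Y Z =
           cov_metric M D' g X (endo_app M J' Y) Z +
           g_app M g X (cov_endo M D' J' Z Y - cov_endo M D J' Z Y)"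
proof -
  have g: "pseudo_riemannian_metric M g" and J: "tensor_field_11 M J"
    using assms(1) by (simp_all add: metallic_like_pseudo_riemannian_def metallic_structure_def
        bundle_automorphism_def)
  note adj = assms(2) and D = assms(3) and conj = assms(4)
    and X = assms(5) and Y = assms(6) and Z = assms(7)
  have D': "linear_connection M D'"
    using conj by (simp add: conjugate_connection_def)
  have J': "tensor_field_11 M J'"
    using adj by (simp add: associated_tensor_def)
  note JX = tensor_field_closed[OF J X] and J'Y = tensor_field_closed[OF J' Y]
  have first: "cov_metric M D g (endo_app M J X) Y Z =
      cov_metric M D g X (endo_app M J' Y) Z +
      g_app M g Y (cov_endo M D' J Z X - cov_endo M D J Z X)"
    by (rule cov_metric_endo_left[OF g J adj D conj X Y Z])
  have dual: "cov_metric M D' g (endo_app M J' Y) X Z =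
      cov_metric M D' g Y (endo_app M J X) Z +
      g_app M g X (cov_endo M D J' Z Y - cov_endo M D' J' Z Y)"
    by (rule cov_metric_endo_left[OF g J' associated_tensor_sym[OF g J adj] D'
          conjugate_connection_sym[OF g D conj] Y X Z])
  have "g_app M g X (cov_endo M D' J' Z Y - cov_endo M D J' Z Y) =
      - g_app M g X (cov_endo M D J' Z Y - cov_endo M D' J' Z Y)"
    by (simp add: g_app_diff_right[OF g X] cov_endo_at D D' J' Y Z)
  with dual have "cov_metric M D' g (endo_app M J X) Y Z =
      cov_metric M D' g X (endo_app M J' Y) Z +
      g_app M g X (cov_endo M D' J' Z Y - cov_endo M D J' Z Y)"
    by (simp add: cov_metric_sym[OF g D' J'Y X Z] cov_metric_sym[OF g D' JX Y Z])
  with first show ?thesis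
    by blast
qed

end
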